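(* Consider the local route-switching dynamical system described in the context, and suppose that the travel time function $t_a$ of every link $a$ is continuously differentiable and non-decreasing. Then for arbitrary (non-negative) initial route flows, with total flow $\sum_{\omega\in\Omega_{rs}}\sum_{i\in P^{\omega}}x^{rs}_{\omega i}(0)=D_{rs}$ for each $(r,s)$, every solution $x(t)$, $t\in[0,\infty)$, of the system converges to the approximated local system optimal (ALSO) state set $$E=\Big\{x\ :\ \Gamma\big(C^{\omega}_i(x)-C^{\kappa}_j(x)-\Delta_{\omega\kappa}-\delta_{rs}\big)\,x^{rs}_{\omega i}=0\ \ \ \forall (r,s)\in R\times S,\ \forall\omega,\kappa\in\Omega_{rs},\ \forall i\in P^{\omega},\ \forall j\in P^{\kappa}\Big\},$$ that is, the distance from $x(t)$ to the set of feasible flow vectors in $E$ tends to $0$ as $t\to\infty$.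
   Context: $R\times S$ is a finite set of global origin-destination (OD) pairs $(r,s)$. For each $(r,s)$, $\Omega_{rs}$ is a finite set of local destinations, and for each $\omega\in\Omega_{rs}$, $P^{\omega}$ is the finite set of local routes from $r$ to $\omega$; each local route is a finite set of directed links (a path). The state $x$ is the vector of all flows $x^{rs}_{\omega i}$, where $x^{rs}_{\omega i}$ is the flow on local route $i\in P^{\omega}$ of travelers of global OD pair $(r,s)$. A flow vector is feasible if all its components are non-negative and $\sum_{\omega\in\Omega_{rs}}\sum_{i\in P^{\omega}}x^{rs}_{\omega i}=D_{rs}$ for every $(r,s)$, where $D_{rs}\geq 0$ is the given demand of $(r,s)$. The dynamics leave the feasible set invariant. The flow $v_a=v_a(x)$ on link $a$ is the sum of all $x^{rs}_{\omega i}$ over routes $i$ containing $a$. Link $a$ has travel time $t_a(v_a)$, with $t_a:[0,\infty)\to[0,\infty)$. Its marginal travel time is $\frac{d}{dv}\big(v\,t_a(v)\big)=t_a(v)+v\,t_a'(v)$ at $v=v_a$, and the marginal travel time $C^{\omega}_i(x)$ of local route $i\in P^{\omega}$ is the sum of the marginal travel times of its links. For each $(r,s)$ and $\omega\in\Omega_{rs}$, the marginal travel time $m^{s}_{\omega}$ from $\omega$ to $s$ (outside the local area) is a fixed constant, and $\Delta_{\omega\kappa}=m^{s}_{\kappa}-m^{s}_{\omega}$ for $\omega,\kappa\in\Omega_{rs}$. The constants $\delta_{rs}\ge 0$ are given tolerances, and $\Gamma(y)=\max(y,0)$. The dynamical system is $$\dot x^{rs}_{\omega i}=\sum_{\kappa\in\Omega_{rs}}\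 \sum_{j\in P^{\kappa},\, j\ne i}\Big[\Gamma\big(C^{\kappa}_j-C^{\omega}_i-\Delta_{\kappa\omega}-\delta_{rs}\big)\,x^{rs}_{\kappa j}-\Gamma\big(C^{\omega}_i-C^{\kappa}_j-\Delta_{\omega\kappa}-\delta_{rs}\big)\,x^{rs}_{\omega i}\Big]$$ for all $(r,s)\in R\times S$, $\omega\in\Omega_{rs}$, $i\in P^{\omega}$. *)

theory Defs
  imports "HOL-Analysis.Analysis" "Graph_Theory.Arc_Walk"
begin

text \<open>
  Type parameters: \<open>'v\<close> nodes of the local area, \<open>'l\<close> directed links, \<open>'s\<close> global destinations
  (which may lie outside the local area, hence a type of their own).
\<close>

record ('v, 'l, 's) local_network =
  network :: "('v, 'l) pre_digraph"
  origins :: "'v set"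
  global_dests :: "'s set"
  local_dests :: "'v \<Rightarrow> 's \<Rightarrow> 'v set"
  routes :: "'v \<Rightarrow> 'v \<Rightarrow> 'l set set"
  demand :: "'v \<Rightarrow> 's \<Rightarrow> real"
  ttime :: "'l \<Rightarrow> real \<Rightarrow> real"
  outer_mtime :: "'s \<Rightarrow> 'v \<Rightarrow> real"
  tolerance :: "'v \<Rightarrow> 's \<Rightarrow> real"

abbreviation od_pairs :: "('v, 'l, 's) local_network \<Rightarrow> ('v \<times> 's) set" where
  "od_pairs N \<equiv> origins N \<times> global_dests N"

text \<open>
  A travel time function lives on \<open>[0, \<infinity>)\<close>; its values at negative arguments are unconstrained.
  Since a route is a simple path, its link set determines its end node, so \<open>routes N r \<omega>\<close> and
  \<open>routes N r \<kappa>\<close> are disjoint for distinct \<open>\<omega>\<close> and \<open>\<kappa>\<close>.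
\<close>

definition valid_network :: "('v, 'l, 's) local_network \<Rightarrow> bool" where
  "valid_network N \<longleftrightarrow>
     wf_digraph (network N) \<and>
     finite (od_pairs N) \<and>
     (\<forall>(r, s) \<in> od_pairs N.
        finite (local_dests N r s) \<and> demand N r s \<ge> 0 \<and> tolerance N r s \<ge> 0 \<and>
        (\<forall>\<omega> \<in> local_dests N r s.
           finite (routes N r \<omega>) \<and>
           (\<forall>i \<in> routes N r \<omega>. \<exists>p. pre_digraph.apath (network N) r p \<omega> \<and> i = set p))) \<and>
     (\<forall>a \<in> arcs (network N). \<forall>v \<ge> 0. ttime N a v \<ge> 0)"

text \<open>Continuous differentiability on \<open>[0, \<infinity>)\<close>, with the one-sided derivative at 0.\<close>

definition C1_on_nonneg :: "(real \<Rightarrow> real) \<Rightarrow> bool" where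
  "C1_on_nonneg f \<longleftrightarrow>
     (\<exists>f'. (\<forall>v \<ge> 0. (f has_real_derivative f' v) (at v within {0..})) \<and> continuous_on {0..} f')"

text \<open>
  The flow \<open>x r s \<omega> i\<close> is meaningful only for index tuples in \<open>flow_indices N\<close>; nothing below
  depends on the other values.
\<close>

type_synonym ('v, 'l, 's) state = "'v \<Rightarrow> 's \<Rightarrow> 'v \<Rightarrow> 'l set \<Rightarrow> real"

definition flow_indices :: "('v, 'l, 's) local_network \<Rightarrow> ('v \<times> 's \<times> 'v \<times> 'l set) set" where
  "flow_indices N =
     {(r, s, \<omega>, i). (r, s) \<in> od_pairs N \<and> \<omega> \<in> local_dests N r s \<and> i \<in> routes N r \<omega>}"

definition feasible :: "('v, 'l, 's) local_network \<Rightarrow> ('v, 'l, 's) state \<Rightarrow> bool" where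
  "feasible N x \<longleftrightarrow>
     (\<forall>(r, s, \<omega>, i) \<in> flow_indices N. x r s \<omega> i \<ge> 0) \<and>
     (\<forall>(r, s) \<in> od_pairs N.
        (\<Sum>\<omega> \<in> local_dests N r s. \<Sum>i \<in> routes N r \<omega>. x r s \<omega> i) = demand N r s)"

definition link_flow :: "('v, 'l, 's) local_network \<Rightarrow> ('v, 'l, 's) state \<Rightarrow> 'l \<Rightarrow> real" where
  "link_flow N x a =
     (\<Sum>(r, s) \<in> od_pairs N. \<Sum>\<omega> \<in> local_dests N r s. \<Sum>i \<in> {i \<in> routes N r \<omega>. a \<in> i}. x r s \<omega> i)"

definition marginal_time :: "(real \<Rightarrow> real) \<Rightarrow> real \<Rightarrow> real" where
  "marginal_time f v = vector_derivative (\<lambda>u. u * f u) (at v within {0..})"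

lemma marginal_time_eq:
  assumes "v \<ge> 0" and "(f has_real_derivative d) (at v within {0..})"
  shows "marginal_time f v = f v + v * d"
proof -
  have "((\<lambda>u. u * f u) has_vector_derivative (f v + v * d)) (at v within {0..})"
    using assms(2)
    by (auto intro!: derivative_eq_intros simp: has_real_derivative_iff_has_vector_derivative [symmetric])
  moreover have "at v within {0..} \<noteq> bot"
  proof -
    have "at_right v \<le> at v within {0..}"
      using assms(1) by (intro at_le) auto
    then show ?thesis
      by (metis bot_unique trivial_limit_at_right_real)
  qed
  ultimately show ?thesis
    unfolding marginal_time_def by (intro vector_derivative_within)
qed

definition route_mtime :: "('v, 'l, 's) local_network \<Rightarrow> ('v, 'l, 's) state \<Rightarrow> 'l set \<Rightarrow> real" where
  "route_mtime N x i = (\<Sum>a \<in> i. marginal_time (ttime N a) (link_flow N x a))"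

definition outer_diff :: "('v, 'l, 's) local_network \<Rightarrow> 's \<Rightarrow> 'v \<Rightarrow> 'v \<Rightarrow> real" where
  "outer_diff N s \<omega> \<kappa> = outer_mtime N s \<kappa> - outer_mtime N s \<omega>"

definition pos_part :: "real \<Rightarrow> real" where
  "pos_part y = max y 0"

text \<open>The rate per unit of flow at which travelers of \<open>(r, s)\<close> leave \<open>(\<omega>, i)\<close> for \<open>(\<kappa>, j)\<close>.\<close>

definition switch_rate ::
  "('v, 'l, 's) local_network \<Rightarrow> ('v, 'l, 's) state \<Rightarrow> 'v \<Rightarrow> 's \<Rightarrow> 'v \<Rightarrow> 'l set \<Rightarrow> 'v \<Rightarrow> 'l set \<Rightarrow> real" where
  "switch_rate N x r s \<omega> i \<kappa> j =
     pos_part (route_mtime N x i - route_mtime N x j - outer_diff N s \<omega> \<kappa> - tolerance N r s)"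

definition flow_rate ::
  "('v, 'l, 's) local_network \<Rightarrow> ('v, 'l, 's) state \<Rightarrow> 'v \<Rightarrow> 's \<Rightarrow> 'v \<Rightarrow> 'l set \<Rightarrow> real" where
  "flow_rate N x r s \<omega> i =
     (\<Sum>\<kappa> \<in> local_dests N r s. \<Sum>j \<in> routes N r \<kappa> - {i}.
        switch_rate N x r s \<kappa> j \<omega> i * x r s \<kappa> j - switch_rate N x r s \<omega> i \<kappa> j * x r s \<omega> i)"

definition is_solution :: "('v, 'l, 's) local_network \<Rightarrow> (real \<Rightarrow> ('v, 'l, 's) state) \<Rightarrow> bool" where
  "is_solution N x \<longleftrightarrow>
     (\<forall>t \<ge> 0. \<forall>(r, s, \<omega>, i) \<in> flow_indices N.
        ((\<lambda>\<tau>. x \<tau> r s \<omega> i) has_real_derivative flow_rate N (x t) r s \<omega> i) (at t within {0..}))"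

definition ALSO_set :: "('v, 'l, 's) local_network \<Rightarrow> ('v, 'l, 's) state set" where
  "ALSO_set N =
     {x. \<forall>(r, s) \<in> od_pairs N. \<forall>\<omega> \<in> local_dests N r s. \<forall>\<kappa> \<in> local_dests N r s.
           \<forall>i \<in> routes N r \<omega>. \<forall>j \<in> routes N r \<kappa>. switch_rate N x r s \<omega> i \<kappa> j * x r s \<omega> i = 0}"

definition state_dist ::
  "('v, 'l, 's) local_network \<Rightarrow> ('v, 'l, 's) state \<Rightarrow> ('v, 'l, 's) state \<Rightarrow> real" where
  "state_dist N x y = L2_set (\<lambda>(r, s, \<omega>, i). x r s \<omega> i - y r s \<omega> i) (flow_indices N)"

text \<open>Meaningful for nonempty \<open>A\<close> only.\<close>

definition state_setdist ::
  "('v, 'l, 's) local_network \<Rightarrow> ('v, 'l, 's) state \<Rightarrow> ('v, 'l, 's) state set \<Rightarrow> real" where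
  "state_setdist N x A = (INF y \<in> A. state_dist N x y)"

end

theory Submission
  imports Defs
begin

text \<open>
  Write \<open>c\<^sub>p\<close> for the marginal travel time of route \<open>p\<close> plus the outer marginal time of its end
  node, so that flow switches from \<open>p\<close> to \<open>q\<close> at rate \<open>\<Gamma>(c\<^sub>p - c\<^sub>q - \<delta>)\<close>. The vector \<open>c\<close> is the
  gradient of \<open>V(x) = \<Sum>\<^sub>a v\<^sub>a t\<^sub>a(v\<^sub>a) + \<Sum>\<^sub>p m\<^sub>p x\<^sub>p\<close>, whence \<open>V\<close> decreases along solutions at
  least as fast as \<open>\<Sum> \<Gamma>(c\<^sub>p - c\<^sub>q - \<delta>)\<^sup>2 x\<^sub>p\<close>, an expression that vanishes exactly on \<open>E\<close>. The
  feasible set is compact, invariant, and the speed on it is bounded, so a solution cannot be far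
  from \<open>E\<close> infinitely often without making \<open>V\<close> unbounded below. Non-emptiness of \<open>E\<close> comes out of
  the same argument.
\<close>

section \<open>Conservative transfer and Lyapunov functions\<close>

text \<open>Trajectories are differentiable at 0 only from the right. At interior points of
  \<open>{a..b}\<close> the filter \<open>at t within {0..}\<close> is \<open>at t\<close>, and at
  the end points continuity suffices, so the mean value argument needs the sign of \<open>f'\<close>
  only strictly between them.\<close>

lemma nonpos_deriv_within_imp_decreasing:
  fixes f f' :: "real \<Rightarrow> real"
  assumes der: "\<And>t. t \<ge> 0 \<Longrightarrow> (f has_real_derivative f' t) (at t within {0..})"
    and nonpos: "\<And>t. a < t \<Longrightarrow> t < b \<Longrightarrow> f' t \<le> 0"
    and "0 \<le> a" "a \<le> b"
  shows "f b \<le> f a"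
proof (rule DERIV_nonpos_imp_decreasing_open [OF \<open>a \<le> b\<close>])
  fix t assume t: "a < t" "t < b"
  have "at t within {0..} = at t"
    by (rule at_within_open_subset [where S = "{0<..}"]) (use t \<open>0 \<le> a\<close> in auto)
  then have "(f has_real_derivative f' t) (at t)"
    using der [of t] t \<open>0 \<le> a\<close> by simp
  then show "\<exists>y. DERIV f t :> y \<and> y \<le> 0"
    using nonpos [OF t] by (intro exI conjI)
next
  have "continuous_on {0..} f"
    by (rule DERIV_continuous_on [where D = f']) (simp add: der)
  then show "continuous_on {a..b} f"
    by (rule continuous_on_subset) (use \<open>0 \<le> a\<close> in auto)
qed

text \<open>Squaring removes the kink of the negative part at 0: the difference quotient there is
  bounded by \<open>\<bar>h\<bar>\<close>. Sums of such squares can therefore measure how far a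
  trajectory is from being non-negative.\<close>

lemma DERIV_min_zero_squared:
  "((\<lambda>u. (min u 0)\<^sup>2) has_real_derivative 2 * min u 0) (at u)" for u :: real
proof (cases u "0::real" rule: linorder_cases)
  case less
  have "((\<lambda>u. u\<^sup>2) has_real_derivative 2 * u) (at u)"
    by (auto intro!: derivative_eq_intros)
  then have "((\<lambda>u. (min u 0)\<^sup>2) has_real_derivative 2 * u) (at u)"
    by (rule has_field_derivative_transform_within_open [where S = "{..<0}"]) (use less in auto)
  then show ?thesis
    using less by simp
next
  case greater
  have "((\<lambda>_. 0) has_real_derivative 0) (at u)"
    by simp
  then have "((\<lambda>u. (min u 0)\<^sup>2) has_real_derivative 0) (at u)"
    by (rule has_field_derivative_transform_within_open [where S = "{0<..}"]) (use greater in auto)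
  then show ?thesis
    using greater by simp
next
  case equal
  have "((\<lambda>h::real. (min h 0)\<^sup>2 / h) \<longlongrightarrow> 0) (at 0)"
  proof (rule Lim_null_comparison)
    show "\<forall>\<^sub>F h::real in at 0. norm ((min h 0)\<^sup>2 / h) \<le> \<bar>h\<bar>"
      by (intro always_eventually) (auto simp: min_def power2_eq_square)
    show "((\<lambda>h::real. \<bar>h\<bar>) \<longlongrightarrow> 0) (at 0)"
      by (rule tendsto_rabs_zero [OF tendsto_ident_at])
  qed
  then show ?thesis
    using equal by (simp add: DERIV_def)
qed

lemma continuous_on_coordinate [continuous_intros]:
  fixes S :: "('i \<Rightarrow> 'b::topological_space) set"
  shows "continuous_on S (\<lambda>z. z p)"
  by (rule continuous_on_subset [OF continuous_on_product_coordinates]) simp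

text \<open>Tychonoff's theorem: every coordinate ranges over a compact factor, which is the
  singleton \<open>{0}\<close> outside \<open>I\<close>. Pinning these coordinates is what permits
  compactness in the full function space.\<close>

lemma compact_zero_extended_box:
  fixes b :: real
  shows "compact {z :: 'i \<Rightarrow> real. (\<forall>p\<in>I. 0 \<le> z p \<and> z p \<le> b) \<and> (\<forall>p. p \<notin> I \<longrightarrow> z p = 0)}"
proof -
  define C where "C p = (if p \<in> I then {0..b} else {0})" for p
  have C: "u \<in> C p \<longleftrightarrow> (p \<in> I \<longrightarrow> 0 \<le> u \<and> u \<le> b) \<and> (p \<notin> I \<longrightarrow> u = 0)" for u p
    by (simp add: C_def)
  have "compactin euclidean (C p)" for p
    by (simp add: C_def)
  then have "compactin (product_topology (\<lambda>_::'i. euclidean) UNIV) (PiE UNIV C)"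
    by (simp only: compactin_PiE) simp
  moreover have "PiE UNIV C =
      {z. (\<forall>p\<in>I. 0 \<le> z p \<and> z p \<le> b) \<and> (\<forall>p. p \<notin> I \<longrightarrow> z p = 0)}"
    unfolding PiE_UNIV_domain Pi_def C by blast
  ultimately show ?thesis
    by (simp add: euclidean_product_topology)
qed

text \<open>
  No regularity of the rates \<open>k\<close> in time is needed, only a bound: the sum of squared negative parts
  satisfies a linear differential inequality.
\<close>

lemma conservative_transfer_nonneg:
  fixes x :: "real \<Rightarrow> 'i \<Rightarrow> real" and k :: "real \<Rightarrow> 'i \<Rightarrow> 'i \<Rightarrow> real"
  assumes I: "finite I"
    and der: "\<And>p t. p \<in> I \<Longrightarrow> t \<ge> 0 \<Longrightarrow>
      ((\<lambda>\<tau>. x \<tau> p) has_real_derivative (\<Sum>q\<in>I. k t q p * x t q - k t p q * x t p)) (at t within {0..})"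
    and k_nonneg: "\<And>p q t. p \<in> I \<Longrightarrow> q \<in> I \<Longrightarrow> 0 \<le> t \<Longrightarrow> t \<le> T \<Longrightarrow> 0 \<le> k t p q"
    and k_le: "\<And>p q t. p \<in> I \<Longrightarrow> q \<in> I \<Longrightarrow> 0 \<le> t \<Longrightarrow> t \<le> T \<Longrightarrow> k t p q \<le> K"
    and init: "\<And>p. p \<in> I \<Longrightarrow> 0 \<le> x 0 p"
    and "0 \<le> T" "p \<in> I"
  shows "0 \<le> x T p"
proof -
  define n where "n t p = min (x t p) 0" for t p
  define x' where "x' t p = (\<Sum>q\<in>I. k t q p * x t q - k t p q * x t p)" for t p
  define W where "W t = (\<Sum>p\<in>I. (n t p)\<^sup>2)" for t
  define W' where "W' t = (\<Sum>p\<in>I. 2 * n t p * x' t p)" for t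
  define c where "c = 2 * K * card I"
  have W: "(W has_real_derivative W' t) (at t within {0..})" if "t \<ge> 0" for t
    unfolding W_def [abs_def] W'_def n_def
    by (intro DERIV_sum DERIV_chain2 [OF DERIV_min_zero_squared])
      (use der that in \<open>auto simp: x'_def\<close>)
  have W'_le: "W' t \<le> c * W t" if t: "0 \<le> t" "t \<le> T" for t
  proof -
    \<comment> \<open>Since \<open>n t p \<le> 0\<close> and \<open>n t q \<le> x t q\<close>,
      replacing \<open>x t q\<close> by \<open>n t q\<close> only enlarges the inflow term; the
      product of negative parts is then bounded by half the sum of their squares. The outflow term
      has a favourable sign because \<open>n t p * x t p \<ge> 0\<close>.\<close>
    have pair: "n t p * (k t q p * x t q - k t p q * x t p) \<le> K * (((n t p)\<^sup>2 + (n t q)\<^sup>2) / 2)"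
      if pq: "p \<in> I" "q \<in> I" for p q
    proof -
      have K: "0 \<le> K"
        using k_nonneg [OF pq t] k_le [OF pq t] by linarith
      have "n t p * x t q \<le> n t p * n t q"
        by (rule mult_left_mono_neg) (auto simp: n_def)
      then have "k t q p * (n t p * x t q) \<le> k t q p * (n t p * n t q)"
        using k_nonneg [OF pq(2) pq(1) t] by (rule mult_left_mono)
      also have "\<dots> \<le> K * (n t p * n t q)"
        using k_le [OF pq(2) pq(1) t]
        by (rule mult_right_mono) (simp add: n_def mult_nonpos_nonpos)
      also have "\<dots> \<le> K * (((n t p)\<^sup>2 + (n t q)\<^sup>2) / 2)"
        using sum_squares_bound [of "n t p" "n t q"] K by (intro mult_left_mono) simp_all
      finally have "k t q p * (n t p * x t q) \<le> K * (((n t p)\<^sup>2 + (n t q)\<^sup>2) / 2)" .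
      moreover have "0 \<le> k t p q * (n t p * x t p)"
        using k_nonneg [OF pq t]
        by (rule mult_nonneg_nonneg) (simp add: n_def min_def mult_nonpos_nonpos)
      ultimately show ?thesis
        by (simp add: algebra_simps)
    qed
    have "W' t = (\<Sum>p\<in>I. 2 * (\<Sum>q\<in>I. n t p * (k t q p * x t q - k t p q * x t p)))"
      unfolding W'_def x'_def by (simp add: sum_distrib_left mult.assoc)
    also have "\<dots> \<le> (\<Sum>p\<in>I. 2 * (\<Sum>q\<in>I. K * (((n t p)\<^sup>2 + (n t q)\<^sup>2) / 2)))"
      using pair by (intro sum_mono mult_left_mono) auto
    also have "\<dots> = K * (\<Sum>p\<in>I. \<Sum>q\<in>I. (n t p)\<^sup>2 + (n t q)\<^sup>2)"
      by (simp add: sum_distrib_left)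
    also have "(\<Sum>p\<in>I. \<Sum>q\<in>I. (n t p)\<^sup>2 + (n t q)\<^sup>2) = 2 * card I * W t"
      by (simp add: sum.distrib W_def flip: sum_distrib_left)
    also have "K * (2 * card I * W t) = c * W t"
      by (simp add: c_def)
    finally show ?thesis .
  qed
  \<comment> \<open>Gronwall's argument: with this integrating factor, \<open>W' \<le> c * W\<close>
    makes \<open>f\<close> decreasing. Hence \<open>W\<close>, which starts at 0, stays 0.\<close>
  define f where "f t = exp (- c * t) * W t" for t
  have f: "(f has_real_derivative exp (- c * t) * (W' t - c * W t)) (at t within {0..})"
    if "t \<ge> 0" for t
    unfolding f_def [abs_def]
    by (rule derivative_eq_intros W that refl)+ (simp add: algebra_simps)
  have "f T \<le> f 0"
  proof (rule nonpos_deriv_within_imp_decreasing [where f = f, OF f])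
    show "exp (- c * t) * (W' t - c * W t) \<le> 0" if "0 < t" "t < T" for t
      using W'_le [of t] that by (intro mult_nonneg_nonpos) auto
  qed (use \<open>0 \<le> T\<close> in auto)
  moreover have "W 0 = 0"
    using init by (simp add: W_def n_def)
  ultimately have "W T \<le> 0"
    by (simp add: f_def mult_le_0_iff)
  moreover have "(n T p)\<^sup>2 \<le> W T"
    unfolding W_def using I \<open>p \<in> I\<close> by (intro member_le_sum) auto
  ultimately have "(n T p)\<^sup>2 \<le> 0"
    by linarith
  then show ?thesis
    by (simp add: n_def min_def split: if_splits)
qed

text \<open>
  A trajectory of bounded speed that is \<open>\<epsilon>\<close>-far from the zero set of \<open>g\<close> stays away from it for a
  fixed time, in which \<open>W\<close> drops by a fixed amount.
\<close>

lemma bounded_speed_lyapunov_convergence: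
  fixes x x' :: "real \<Rightarrow> 'i \<Rightarrow> real" and g :: "('i \<Rightarrow> real) \<Rightarrow> real" and W W' :: "real \<Rightarrow> real"
  assumes I: "finite I"
    and F: "compact F" "\<And>t. t \<ge> 0 \<Longrightarrow> x t \<in> F"
    and g: "continuous_on F g" "\<And>z. z \<in> F \<Longrightarrow> 0 \<le> g z"
    and der: "\<And>p t. p \<in> I \<Longrightarrow> t \<ge> 0 \<Longrightarrow>
      ((\<lambda>\<tau>. x \<tau> p) has_real_derivative x' t p) (at t within {0..})"
    and speed: "\<And>p t. p \<in> I \<Longrightarrow> t \<ge> 0 \<Longrightarrow> \<bar>x' t p\<bar> \<le> B"
    and W: "\<And>t. t \<ge> 0 \<Longrightarrow> (W has_real_derivative W' t) (at t within {0..})"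
    and W': "\<And>t. t \<ge> 0 \<Longrightarrow> W' t \<le> - g (x t)"
    and W_ge: "\<And>t. t \<ge> 0 \<Longrightarrow> b \<le> W t"
    and Z_def: "Z = {z \<in> F. g z = 0}"
  shows "Z \<noteq> {}" "((\<lambda>t. INF z\<in>Z. L2_set (\<lambda>p. x t p - z p) I) \<longlongrightarrow> 0) at_top"
proof -
  let ?d = "\<lambda>y z. L2_set (\<lambda>p. y p - z p) I"
  have L_triv: "?d y y = 0" for y :: "'i \<Rightarrow> real"
    by (simp add: L2_set_def)
  have g_bound: "\<exists>\<eta>>0. \<forall>y\<in>F. (\<forall>z\<in>Z. \<epsilon> \<le> ?d y z) \<longrightarrow> \<eta> \<le> g y" if "\<epsilon> > 0" for \<epsilon>
  proof -
    \<comment> \<open>\<open>K\<close> is compact and misses \<open>Z\<close>, so the continuous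
      function \<open>g\<close> has a positive minimum on it. An empty \<open>Z\<close> is allowed
      here and gives \<open>K = F\<close>; this is how the non-emptiness of \<open>Z\<close> can be
      a conclusion.\<close>
    define K where "K = F - (\<Union>z\<in>Z. {y. ?d y z < \<epsilon>})"
    have "open {y. ?d y z < \<epsilon>}" for z
      unfolding L2_set_def by (intro open_Collect_less continuous_intros)
    then have "compact K"
      unfolding K_def by (intro compact_diff F open_UN) auto
    have K_iff: "y \<in> K \<longleftrightarrow> y \<in> F \<and> (\<forall>z\<in>Z. \<epsilon> \<le> ?d y z)" for y
      by (auto simp: K_def not_less)
    show ?thesis
    proof (cases "K = {}")
      case True
      then show ?thesis
        using K_iff by (intro exI [of _ 1]) auto
    next
      case False
      have "continuous_on K g"
        using g(1) by (rule continuous_on_subset) (auto simp: K_def)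
      then obtain y0 where y0: "y0 \<in> K" "\<forall>y\<in>K. g y0 \<le> g y"
        using continuous_attains_inf [OF \<open>compact K\<close> False] by blast
      have "g y0 \<noteq> 0"
      proof
        assume "g y0 = 0"
        then have "y0 \<in> Z"
          using y0(1) by (simp add: K_iff Z_def)
        then have "\<epsilon> \<le> ?d y0 y0"
          using y0(1) by (simp only: K_iff)
        then show False
          using \<open>\<epsilon> > 0\<close> L_triv [of y0] by simp
      qed
      moreover have "g y0 \<ge> 0"
        using g(2) y0(1) by (simp add: K_iff)
      ultimately have "g y0 > 0"
        by simp
      then show ?thesis
        using y0(2) K_iff by blast
    qed
  qed
  \<comment> \<open>The factor \<open>card I\<close> comes from bounding the Euclidean norm by the
    sum of the absolute coordinates.\<close>
  have lipschitz: "?d (x s) (x t) \<le> card I * B * (s - t)" if "0 \<le> t" "t \<le> s" for s t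
  proof -
    have "\<bar>x s p - x t p\<bar> \<le> B * (s - t)" if "p \<in> I" for p
      using field_differentiable_bound [of "{0..}" "\<lambda>\<tau>. x \<tau> p" "\<lambda>\<tau>. x' \<tau> p" B s t]
        der [OF \<open>p \<in> I\<close>] speed [OF \<open>p \<in> I\<close>] \<open>0 \<le> t\<close> \<open>t \<le> s\<close> by auto
    then have "(\<Sum>p\<in>I. \<bar>x s p - x t p\<bar>) \<le> card I * (B * (s - t))"
      by (intro sum_bounded_above) auto
    then show ?thesis
      using L2_set_le_sum_abs [of "\<lambda>p. x s p - x t p" I] by simp
  qed
  have W_mono: "W s \<le> W t" if "0 \<le> t" "t \<le> s" for s t
  proof (rule nonpos_deriv_within_imp_decreasing [where f = W, OF W])
    show "W' r \<le> 0" if "t < r" for r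
      using W' [of r] g(2) [OF F(2), of r] \<open>t < r\<close> \<open>0 \<le> t\<close> by linarith
  qed (use that in auto)
  have close: "\<forall>\<^sub>F t in at_top. \<exists>z\<in>Z. ?d (x t) z < \<epsilon>" if "\<epsilon> > 0" for \<epsilon>
  proof -
    obtain \<eta> where \<eta>: "\<eta> > 0" "\<And>y. y \<in> F \<Longrightarrow> \<forall>z\<in>Z. \<epsilon> / 2 \<le> ?d y z \<Longrightarrow> \<eta> \<le> g y"
      using g_bound [of "\<epsilon> / 2"] \<open>\<epsilon> > 0\<close> by auto
    \<comment> \<open>Within time \<open>\<tau>\<close> the trajectory moves by at most
      \<open>\<epsilon> / 2\<close>. The summand 1 keeps the denominator positive, and the absolute
      value covers an empty \<open>I\<close>, for which \<open>B\<close> may be negative.\<close>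
    define \<tau> where "\<tau> = \<epsilon> / (2 * (card I * \<bar>B\<bar> + 1))"
    have den: "card I * \<bar>B\<bar> + 1 > 0"
      by (intro add_nonneg_pos) auto
    have "\<tau> > 0"
      unfolding \<tau>_def using \<open>\<epsilon> > 0\<close> den by simp
    have speed_half: "card I * B * u \<le> \<epsilon> / 2" if "0 \<le> u" "u \<le> \<tau>" for u
    proof -
      have "card I * B \<le> card I * \<bar>B\<bar> + 1"
        by (intro add_increasing2 mult_left_mono) auto
      then have "card I * B * u \<le> (card I * \<bar>B\<bar> + 1) * \<tau>"
        by (intro mult_mono) (use that den in auto)
      also have "\<dots> = \<epsilon> / 2"
        unfolding \<tau>_def using den by (simp only: times_divide_eq_right) (simp add: divide_simps)
      finally show ?thesis .
    qed
    \<comment> \<open>From \<open>T\<close> on, \<open>W\<close> exceeds its infimum by less than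
      \<open>\<eta> * \<tau>\<close>, so it can no longer afford the drop that a stay of length
      \<open>\<tau>\<close> away from \<open>Z\<close> would cause.\<close>
    define l where "l = Inf (W ` {0..})"
    have bdd: "bdd_below (W ` {0..})"
      using W_ge by (intro bdd_belowI2 [of _ b]) simp
    have "l < l + \<eta> * \<tau>"
      using \<open>\<eta> > 0\<close> \<open>\<tau> > 0\<close> by simp
    then have "\<exists>w\<in>W ` {0..}. w < l + \<eta> * \<tau>"
      unfolding l_def by (intro cInf_lessD) auto
    then obtain T where T: "T \<ge> 0" "W T < l + \<eta> * \<tau>"
      by auto
    have "\<exists>z\<in>Z. ?d (x t) z < \<epsilon>" if "t \<ge> T" for t
    proof (rule ccontr)
      assume "\<not> (\<exists>z\<in>Z. ?d (x t) z < \<epsilon>)"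
      then have far: "\<epsilon> \<le> ?d (x t) z" if "z \<in> Z" for z
        using that by (auto simp: not_less)
      have "t \<ge> 0"
        using T(1) that by simp
      have drop: "\<eta> \<le> g (x s)" if s: "t < s" "s < t + \<tau>" for s
      proof (rule \<eta>(2))
        show "x s \<in> F"
          using F s \<open>t \<ge> 0\<close> by simp
        show "\<forall>z\<in>Z. \<epsilon> / 2 \<le> ?d (x s) z"
        proof
          fix z assume "z \<in> Z"
          have "?d (x t) z \<le> ?d (x t) (x s) + ?d (x s) z"
            using L2_set_triangle_ineq [of "\<lambda>p. x t p - x s p" "\<lambda>p. x s p - z p" I] by simp
          moreover have "?d (x t) (x s) = ?d (x s) (x t)"
            by (simp add: L2_set_def power2_commute)
          moreover have "?d (x s) (x t) \<le> \<epsilon> / 2"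
            using lipschitz [of t s] speed_half [of "s - t"] s \<open>t \<ge> 0\<close> by simp
          ultimately show "\<epsilon> / 2 \<le> ?d (x s) z"
            using far [OF \<open>z \<in> Z\<close>] by simp
        qed
      qed
      \<comment> \<open>Adding the linear term \<open>\<eta> * s\<close> turns the bound
        \<open>W' s \<le> - \<eta>\<close> into monotonicity.\<close>
      have "W (t + \<tau>) + \<eta> * (t + \<tau>) \<le> W t + \<eta> * t"
      proof (rule nonpos_deriv_within_imp_decreasing [where f = "\<lambda>s. W s + \<eta> * s"])
        show "((\<lambda>s. W s + \<eta> * s) has_real_derivative (W' s + \<eta>)) (at s within {0..})"
          if "s \<ge> 0" for s
          by (rule derivative_eq_intros W that refl)+ simp
        show "W' s + \<eta> \<le> 0" if "t < s" "s < t + \<tau>" for s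
          using W' [of s] drop [of s] that \<open>t \<ge> 0\<close> by simp
      qed (use \<open>t \<ge> 0\<close> \<open>\<tau> > 0\<close> in auto)
      moreover have "W t \<le> W T"
        using W_mono T(1) that by blast
      moreover have "l \<le> W (t + \<tau>)"
        unfolding l_def using bdd \<open>t \<ge> 0\<close> \<open>\<tau> > 0\<close> by (intro cInf_lower) auto
      ultimately show False
        using T(2) by (simp add: algebra_simps)
    qed
    then show ?thesis
      unfolding eventually_at_top_linorder by blast
  qed
  \<comment> \<open>Being eventually within distance 1 of some point of \<open>Z\<close> already
    provides such a point. The infimum in the second claim is thus a genuine distance.\<close>
  show "Z \<noteq> {}"
    using eventually_happens [OF close [OF zero_less_one]] by auto
  show "((\<lambda>t. INF z\<in>Z. ?d (x t) z) \<longlongrightarrow> 0) at_top"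
  proof (rule tendstoI)
    fix \<epsilon> :: real assume "\<epsilon> > 0"
    have bdd: "bdd_below (?d y ` Z)" for y
      by (rule bdd_belowI [of _ 0]) (auto simp: L2_set_nonneg)
    show "\<forall>\<^sub>F t in at_top. dist (INF z\<in>Z. ?d (x t) z) 0 < \<epsilon>"
      using close [OF \<open>\<epsilon> > 0\<close>]
    proof eventually_elim
      case (elim t)
      then have "(INF z\<in>Z. ?d (x t) z) < \<epsilon>"
        using cINF_lower [OF bdd] by (meson le_less_trans)
      moreover have "0 \<le> (INF z\<in>Z. ?d (x t) z)"
        using \<open>Z \<noteq> {}\<close> by (intro cINF_greatest) (auto simp: L2_set_nonneg)
      ultimately show ?case
        by simp
    qed
  qed
qed

section \<open>Route switching on a flat index set\<close>

text \<open>
  Here \<open>total a v\<close> stands for \<open>v t\<^sub>a(v)\<close>. Non-negativity of the flows has to be derived without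
  any regularity of \<open>marginal a\<close> at negative arguments, hence the separate boundedness assumption,
  whose interval may reach below 0.
\<close>

locale route_switching =
  fixes I :: "'i set" and links :: "'i \<Rightarrow> 'a set" and grp :: "'i \<Rightarrow> 'g"
    and outer :: "'i \<Rightarrow> real" and tol :: "'g \<Rightarrow> real"
    and total marginal :: "'a \<Rightarrow> real \<Rightarrow> real"
  assumes finite_I: "finite I"
    and finite_links: "\<And>p. p \<in> I \<Longrightarrow> finite (links p)"
    and tol_nonneg: "\<And>p. p \<in> I \<Longrightarrow> 0 \<le> tol (grp p)"
    and DERIV_total: "\<And>p a v. p \<in> I \<Longrightarrow> a \<in> links p \<Longrightarrow> 0 \<le> v \<Longrightarrow>
      (total a has_real_derivative marginal a v) (at v within {0..})"
    and continuous_marginal: "\<And>p a. p \<in> I \<Longrightarrow> a \<in> links p \<Longrightarrow> continuous_on {0..} (marginal a)"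
    and bounded_marginal: "\<And>p a u v. p \<in> I \<Longrightarrow> a \<in> links p \<Longrightarrow> bounded (marginal a ` {u..v})"
begin

definition load :: "('i \<Rightarrow> real) \<Rightarrow> 'a \<Rightarrow> real" where
  "load z a = (\<Sum>p\<in>{p \<in> I. a \<in> links p}. z p)"

definition cost :: "('i \<Rightarrow> real) \<Rightarrow> 'i \<Rightarrow> real" where
  "cost z p = (\<Sum>a\<in>links p. marginal a (load z a)) + outer p"

text \<open>Letting rates vanish across groups allows \<open>velocity\<close> to sum over all of
  \<open>I\<close>. Its diagonal term cancels, so no index has to be excluded.\<close>

definition rate :: "('i \<Rightarrow> real) \<Rightarrow> 'i \<Rightarrow> 'i \<Rightarrow> real" where
  "rate z p q = (if grp p = grp q then max (cost z p - cost z q - tol (grp p)) 0 else 0)"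

definition velocity :: "('i \<Rightarrow> real) \<Rightarrow> 'i \<Rightarrow> real" where
  "velocity z p = (\<Sum>q\<in>I. rate z q p * z q - rate z p q * z p)"

definition potential :: "('i \<Rightarrow> real) \<Rightarrow> real" where
  "potential z = (\<Sum>a\<in>\<Union>(links ` I). total a (load z a)) + (\<Sum>p\<in>I. outer p * z p)"

definition dissipation :: "('i \<Rightarrow> real) \<Rightarrow> real" where
  "dissipation z = (\<Sum>p\<in>I. \<Sum>q\<in>I. (rate z p q)\<^sup>2 * z p)"

text \<open>Vanishing outside \<open>I\<close> makes this set compact in the function space. For a
  group without members the sum is empty, so the condition forces \<open>D j = 0\<close>
  there.\<close>

definition feasible_flows :: "('g \<Rightarrow> real) \<Rightarrow> ('i \<Rightarrow> real) set" where
  "feasible_flows D = {z. (\<forall>p\<in>I. 0 \<le> z p) \<and> (\<forall>j. (\<Sum>p | p \<in> I \<and> grp p = j. z p) = D j) \<and>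
     (\<forall>p. p \<notin> I \<longrightarrow> z p = 0)}"

lemma finite_all_links: "finite (\<Union>(links ` I))"
  using finite_I finite_links by blast

lemma rate_nonneg: "0 \<le> rate z p q"
  by (simp add: rate_def)

lemma load_nonneg: "0 \<le> load z a" if "\<And>p. p \<in> I \<Longrightarrow> 0 \<le> z p"
  unfolding load_def using that by (intro sum_nonneg) simp

section \<open>Compactness of the feasible set and continuity on it\<close>

lemma compact_feasible_flows: "compact (feasible_flows D)"
proof -
  \<comment> \<open>Each flow is at most the demand of its own group; summing absolute values gives
    one bound for all coordinates.\<close>
  define b where "b = (\<Sum>p\<in>I. \<bar>D (grp p)\<bar>)"
  have le_b: "z p \<le> b" if z: "z \<in> feasible_flows D" and p: "p \<in> I" for z p
  proof -
    have "z p \<le> (\<Sum>q | q \<in> I \<and> grp q = grp p. z q)"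
      by (rule member_le_sum) (use z p finite_I in \<open>auto simp: feasible_flows_def\<close>)
    also have "\<dots> = D (grp p)"
      using z by (simp add: feasible_flows_def)
    also have "\<dots> \<le> \<bar>D (grp p)\<bar>"
      by simp
    also have "\<dots> \<le> b"
      unfolding b_def by (rule member_le_sum) (use p finite_I in auto)
    finally show ?thesis .
  qed
  let ?box = "{z. (\<forall>p\<in>I. 0 \<le> z p \<and> z p \<le> b) \<and> (\<forall>p. p \<notin> I \<longrightarrow> z p = 0)}"
  let ?sums = "{z :: 'i \<Rightarrow> real. \<forall>j. (\<Sum>p | p \<in> I \<and> grp p = j. z p) = D j}"
  have "closed ?sums"
    by (intro closed_Collect_all closed_Collect_eq continuous_intros)
  moreover have "feasible_flows D = ?box \<inter> ?sums"
  proof (rule set_eqI)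
    show "z \<in> feasible_flows D \<longleftrightarrow> z \<in> ?box \<inter> ?sums" for z
      using le_b [of z] unfolding feasible_flows_def by simp blast
  qed
  ultimately show ?thesis
    by (simp add: compact_zero_extended_box compact_Int_closed)
qed

lemma continuous_on_load [continuous_intros]: "continuous_on S (\<lambda>z. load z a)"
  unfolding load_def by (intro continuous_intros)

lemma continuous_on_cost:
  assumes "p \<in> I"
  shows "continuous_on (feasible_flows D) (\<lambda>z. cost z p)"
proof -
  have "continuous_on (feasible_flows D) (\<lambda>z. marginal a (load z a))" if "a \<in> links p" for a
    by (rule continuous_on_compose2 [OF continuous_marginal [OF assms that]])
      (auto intro!: continuous_intros load_nonneg simp: feasible_flows_def)
  then show ?thesis
    unfolding cost_def by (intro continuous_intros)
qed

lemma continuous_on_rate: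
  assumes "p \<in> I" "q \<in> I"
  shows "continuous_on (feasible_flows D) (\<lambda>z. rate z p q)"
  unfolding rate_def using assms
  by (cases "grp p = grp q") (auto intro!: continuous_intros continuous_on_cost)

lemma continuous_on_velocity:
  assumes "p \<in> I"
  shows "continuous_on (feasible_flows D) (\<lambda>z. velocity z p)"
  unfolding velocity_def using assms by (intro continuous_intros continuous_on_rate)

lemma continuous_on_dissipation: "continuous_on (feasible_flows D) dissipation"
  unfolding dissipation_def [abs_def] by (intro continuous_intros continuous_on_rate)

lemma continuous_on_potential: "continuous_on (feasible_flows D) potential"
proof -
  have "continuous_on (feasible_flows D) (\<lambda>z. total a (load z a))" if a: "a \<in> \<Union>(links ` I)" for a
  proof -
    have "(total a has_real_derivative marginal a v) (at v within {0..})" if "v \<in> {0..}" for v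
      using a DERIV_total that by auto
    then have "continuous_on {0..} (total a)"
      by (rule DERIV_continuous_on)
    then show ?thesis
      by (rule continuous_on_compose2)
        (auto intro!: continuous_intros load_nonneg simp: feasible_flows_def)
  qed
  then show ?thesis
    unfolding potential_def [abs_def] by (intro continuous_intros)
qed

section \<open>Dissipation and descent of the potential\<close>

lemma dissipation_nonneg: "z \<in> feasible_flows D \<Longrightarrow> 0 \<le> dissipation z"
  unfolding dissipation_def feasible_flows_def by (auto intro!: sum_nonneg)

lemma dissipation_eq_0_iff:
  assumes "z \<in> feasible_flows D"
  shows "dissipation z = 0 \<longleftrightarrow> (\<forall>p\<in>I. \<forall>q\<in>I. rate z p q * z p = 0)"
proof -
  have "0 \<le> (rate z p q)\<^sup>2 * z p" if "p \<in> I" for p q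
    using assms that by (simp add: feasible_flows_def)
  then show ?thesis
    unfolding dissipation_def using finite_I
    by (simp add: sum_nonneg_eq_0_iff sum_nonneg)
qed

text \<open>The left side is the chain-rule derivative of \<open>potential\<close> in direction
  \<open>velocity z\<close>, \<open>load\<close> being linear. Exchanging the sums over links and
  routes shows that \<open>cost z\<close> is the gradient of \<open>potential\<close>.\<close>

lemma marginal_cost_of_velocity:
  "(\<Sum>a\<in>\<Union>(links ` I). marginal a (load z a) * load (velocity z) a) +
     (\<Sum>p\<in>I. outer p * velocity z p) = (\<Sum>p\<in>I. cost z p * velocity z p)"
proof -
  let ?A = "\<Union>(links ` I)"
  have "(\<Sum>a\<in>?A. marginal a (load z a) * load (velocity z) a) =
      (\<Sum>a\<in>?A. \<Sum>p | p \<in> I \<and> a \<in> links p. marginal a (load z a) * velocity z p)"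
    by (simp add: load_def sum_distrib_left)
  also have "\<dots> = (\<Sum>p\<in>I. \<Sum>a | a \<in> ?A \<and> a \<in> links p. marginal a (load z a) * velocity z p)"
    by (rule sum.swap_restrict [OF finite_all_links finite_I])
  also have "\<dots> = (\<Sum>p\<in>I. (\<Sum>a\<in>links p. marginal a (load z a)) * velocity z p)"
  proof (rule sum.cong [OF refl])
    fix p assume "p \<in> I"
    then have "{a. a \<in> ?A \<and> a \<in> links p} = links p"
      by blast
    then show "(\<Sum>a | a \<in> ?A \<and> a \<in> links p. marginal a (load z a) * velocity z p) =
        (\<Sum>a\<in>links p. marginal a (load z a)) * velocity z p"
      by (simp add: sum_distrib_right)
  qed
  finally show ?thesis
    by (simp add: cost_def distrib_right sum.distrib)
qed

text \<open>Exchanging the names \<open>p\<close> and \<open>q\<close> in the inflow sum collects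
  all terms of the transfer from \<open>p\<close> to \<open>q\<close>, with factor
  \<open>cost z q - cost z p\<close>. Where the rate is positive, the non-negative tolerance makes
  the cost advantage at least the rate, whence the square.\<close>

lemma cost_velocity_le:
  assumes "\<And>p. p \<in> I \<Longrightarrow> 0 \<le> z p"
  shows "(\<Sum>p\<in>I. cost z p * velocity z p) \<le> - dissipation z"
proof -
  have "(\<Sum>p\<in>I. cost z p * velocity z p) =
      (\<Sum>p\<in>I. \<Sum>q\<in>I. cost z p * (rate z q p * z q)) - (\<Sum>p\<in>I. \<Sum>q\<in>I. cost z p * (rate z p q * z p))"
    by (simp add: velocity_def sum_distrib_left right_diff_distrib sum_subtractf)
  also have "(\<Sum>p\<in>I. \<Sum>q\<in>I. cost z p * (rate z q p * z q)) =
      (\<Sum>p\<in>I. \<Sum>q\<in>I. cost z q * (rate z p q * z p))"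
    by (rule sum.swap)
  finally have "(\<Sum>p\<in>I. cost z p * velocity z p) =
      (\<Sum>p\<in>I. \<Sum>q\<in>I. (cost z q - cost z p) * rate z p q * z p)"
    by (simp add: left_diff_distrib sum_subtractf mult.assoc)
  also have "\<dots> \<le> (\<Sum>p\<in>I. \<Sum>q\<in>I. - ((rate z p q)\<^sup>2 * z p))"
  proof (intro sum_mono)
    fix p q assume pq: "p \<in> I" "q \<in> I"
    have "rate z p q * rate z p q \<le> (cost z p - cost z q) * rate z p q"
    proof (cases "rate z p q = 0")
      case False
      then have "rate z p q \<le> cost z p - cost z q"
        using tol_nonneg [OF pq(1)] by (auto simp: rate_def split: if_splits)
      then show ?thesis
        by (intro mult_right_mono rate_nonneg)
    qed simp
    then have "rate z p q * rate z p q * z p \<le> (cost z p - cost z q) * rate z p q * z p"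
      by (rule mult_right_mono) (use assms pq in simp)
    then show "(cost z q - cost z p) * rate z p q * z p \<le> - ((rate z p q)\<^sup>2 * z p)"
      by (simp add: algebra_simps power2_eq_square)
  qed
  finally show ?thesis
    by (simp add: dissipation_def sum_negf)
qed

text \<open>Rates to and from other groups are 0, and within a group each transfer occurs once as a
  gain and once as a loss. Hence the demands are conserved.\<close>

lemma sum_velocity_group: "(\<Sum>p | p \<in> I \<and> grp p = j. velocity z p) = 0"
proof -
  let ?G = "{p \<in> I. grp p = j}"
  have "velocity z p = (\<Sum>q\<in>?G. rate z q p * z q - rate z p q * z p)" if "p \<in> ?G" for p
    unfolding velocity_def
    by (rule sum.mono_neutral_right) (use finite_I that in \<open>auto simp: rate_def\<close>)
  then have "(\<Sum>p\<in>?G. velocity z p) =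
      (\<Sum>p\<in>?G. \<Sum>q\<in>?G. rate z q p * z q) - (\<Sum>p\<in>?G. \<Sum>q\<in>?G. rate z p q * z p)"
    by (simp add: sum_subtractf)
  also have "\<dots> = 0"
    by (subst sum.swap) simp
  finally show ?thesis .
qed

end

section \<open>Trajectories: invariance of the feasible set and convergence\<close>

locale route_switching_solution =
  route_switching I links grp outer tol total marginal
  for I :: "'i set" and links :: "'i \<Rightarrow> 'a set" and grp :: "'i \<Rightarrow> 'g"
    and outer tol total marginal +
  fixes x :: "real \<Rightarrow> 'i \<Rightarrow> real" and D :: "'g \<Rightarrow> real"
  assumes DERIV_x: "\<And>p t. p \<in> I \<Longrightarrow> 0 \<le> t \<Longrightarrow>
      ((\<lambda>\<tau>. x \<tau> p) has_real_derivative velocity (x t) p) (at t within {0..})"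
    and x_0: "x 0 \<in> feasible_flows D"
    and x_outside: "\<And>p t. p \<notin> I \<Longrightarrow> x t p = 0"
begin

text \<open>This supplies the bound that \<open>conservative_transfer_nonneg\<close> asks for, so it
  must not presuppose non-negative flows. Loads are continuous in time and stay in some
  \<open>{-u..u}\<close>, on which \<open>bounded_marginal\<close> controls the marginal
  times.\<close>

lemma rate_bounded_on_trajectory:
  "\<exists>K. \<forall>t\<in>{0..T}. \<forall>p\<in>I. \<forall>q\<in>I. rate (x t) p q \<le> K"
proof -
  have x_cont: "continuous_on {0..T} (\<lambda>t. x t p)" if "p \<in> I" for p
  proof (rule continuous_on_subset)
    show "continuous_on {0..} (\<lambda>t. x t p)"
      by (rule DERIV_continuous_on [where D = "\<lambda>t. velocity (x t) p"]) (simp add: DERIV_x that)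
  qed auto
  have "\<exists>M. \<forall>t\<in>{0..T}. \<bar>marginal a (load (x t) a)\<bar> \<le> M" if a: "a \<in> \<Union>(links ` I)" for a
  proof -
    have "continuous_on {0..T} (\<lambda>t. load (x t) a)"
      unfolding load_def by (intro continuous_intros x_cont) simp
    then have "bounded ((\<lambda>t. load (x t) a) ` {0..T})"
      by (intro compact_imp_bounded compact_continuous_image) auto
    then obtain u where u: "\<bar>load (x t) a\<bar> \<le> u" if "t \<in> {0..T}" for t
      by (force simp: bounded_iff)
    have "bounded (marginal a ` {-u..u})"
      using a bounded_marginal by blast
    then obtain M where M: "\<And>v. v \<in> {-u..u} \<Longrightarrow> \<bar>marginal a v\<bar> \<le> M"
      by (force simp: bounded_iff)
    have "\<bar>marginal a (load (x t) a)\<bar> \<le> M" if "t \<in> {0..T}" for t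
      using u [OF that] by (intro M) (simp add: abs_le_iff)
    then show ?thesis
      by blast
  qed
  then obtain M where M: "\<And>a t. a \<in> \<Union>(links ` I) \<Longrightarrow> t \<in> {0..T} \<Longrightarrow> \<bar>marginal a (load (x t) a)\<bar> \<le> M a"
    by metis
  define K where "K p = \<bar>\<Sum>a\<in>links p. M a\<bar> + \<bar>outer p\<bar>" for p
  have cost_le: "\<bar>cost (x t) p\<bar> \<le> (\<Sum>p\<in>I. K p)" if "p \<in> I" "t \<in> {0..T}" for p t
  proof -
    have "\<bar>\<Sum>a\<in>links p. marginal a (load (x t) a)\<bar> \<le> (\<Sum>a\<in>links p. M a)"
      using that by (intro order_trans [OF sum_abs] sum_mono M) auto
    then have "\<bar>cost (x t) p\<bar> \<le> K p"
      unfolding cost_def K_def by linarith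
    also have "\<dots> \<le> (\<Sum>p\<in>I. K p)"
      using that finite_I by (intro member_le_sum) (auto simp: K_def)
    finally show ?thesis .
  qed
  have "rate (x t) p q \<le> 2 * (\<Sum>p\<in>I. K p)" if "t \<in> {0..T}" "p \<in> I" "q \<in> I" for t p q
    using cost_le [of p t] cost_le [of q t] tol_nonneg [of p] that by (auto simp: rate_def)
  then show ?thesis
    by blast
qed

lemma x_feasible:
  assumes "0 \<le> t"
  shows "x t \<in> feasible_flows D"
proof -
  obtain K where K: "\<forall>s\<in>{0..t}. \<forall>p\<in>I. \<forall>q\<in>I. rate (x s) p q \<le> K"
    using rate_bounded_on_trajectory by blast
  have "0 \<le> x t p" if "p \<in> I" for p
  proof (rule conservative_transfer_nonneg [where x = x and k = "\<lambda>s. rate (x s)" and I = I and K = K])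
    show "((\<lambda>\<tau>. x \<tau> p) has_real_derivative
        (\<Sum>q\<in>I. rate (x s) q p * x s q - rate (x s) p q * x s p)) (at s within {0..})"
      if "p \<in> I" "0 \<le> s" for p s
      using DERIV_x [OF that] by (simp add: velocity_def)
    show "0 \<le> x 0 p" if "p \<in> I" for p
      using x_0 that by (simp add: feasible_flows_def)
  qed (use K that assms in \<open>simp_all add: finite_I rate_nonneg\<close>)
  moreover have "(\<Sum>p | p \<in> I \<and> grp p = j. x t p) = D j" for j
  proof -
    let ?f = "\<lambda>\<tau>. \<Sum>p | p \<in> I \<and> grp p = j. x \<tau> p"
    have "(?f has_real_derivative (\<Sum>p | p \<in> I \<and> grp p = j. velocity (x s) p)) (at s within {0..})"
      if "0 \<le> s" for s
      by (intro DERIV_sum DERIV_x) (use that in auto)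
    then have "\<exists>c. \<forall>s\<in>{0..}. ?f s = c"
      by (intro has_field_derivative_zero_constant) (auto simp: sum_velocity_group)
    then have "?f t = ?f 0"
      using assms by auto
    then show ?thesis
      using x_0 by (simp add: feasible_flows_def)
  qed
  ultimately show ?thesis
    by (simp add: feasible_flows_def x_outside)
qed

lemma DERIV_potential:
  assumes t: "0 \<le> t"
  shows "((\<lambda>\<tau>. potential (x \<tau>)) has_real_derivative (\<Sum>p\<in>I. cost (x t) p * velocity (x t) p))
    (at t within {0..})"
proof -
  have load: "((\<lambda>\<tau>. load (x \<tau>) a) has_real_derivative load (velocity (x t)) a) (at t within {0..})" for a
    unfolding load_def by (intro DERIV_sum DERIV_x) (use t in auto)
  have "((\<lambda>\<tau>. total a (load (x \<tau>) a)) has_real_derivative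
      marginal a (load (x t) a) * load (velocity (x t)) a) (at t within {0..})"
    if a: "a \<in> \<Union>(links ` I)" for a
  proof -
    have nonneg: "0 \<le> load (x s) a" if "0 \<le> s" for s
      using x_feasible [OF that] by (intro load_nonneg) (simp add: feasible_flows_def)
    have "(total a has_real_derivative marginal a (load (x t) a)) (at (load (x t) a) within {0..})"
      using a DERIV_total nonneg t by blast
    \<comment> \<open>The chain rule needs the outer derivative only within the set of loads
      attained by the trajectory. By feasibility this lies in \<open>{0..}\<close>, so the one-sided
      derivative at load 0 suffices.\<close>
    then have "(total a has_real_derivative marginal a (load (x t) a))
        (at (load (x t) a) within (\<lambda>s. load (x s) a) ` {0..})"
      by (rule DERIV_subset) (auto intro: nonneg)
    from DERIV_image_chain [OF this load] show ?thesis
      by (simp add: o_def)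
  qed
  then show ?thesis
    unfolding marginal_cost_of_velocity [symmetric] potential_def
    by (intro DERIV_add DERIV_sum DERIV_cmult DERIV_x) (use t in auto)
qed

text \<open>Velocity and potential are continuous on the compact feasible set, hence bounded; this
  gives the speed bound and the lower bound for the Lyapunov function. The role of \<open>g\<close>
  is played by \<open>dissipation\<close>.\<close>

lemma converges_to_equilibria:
  defines "Z \<equiv> {z \<in> feasible_flows D. \<forall>p\<in>I. \<forall>q\<in>I. rate z p q * z p = 0}"
  shows "Z \<noteq> {}" "((\<lambda>t. INF z\<in>Z. L2_set (\<lambda>p. x t p - z p) I) \<longlongrightarrow> 0) at_top"
proof -
  have "\<exists>B. \<forall>z\<in>feasible_flows D. \<bar>velocity z p\<bar> \<le> B" if "p \<in> I" for p
    using compact_imp_bounded [OF compact_continuous_image [OF continuous_on_velocity [OF that]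
      compact_feasible_flows]] by (force simp: bounded_iff)
  then obtain B where B: "\<And>p z. p \<in> I \<Longrightarrow> z \<in> feasible_flows D \<Longrightarrow> \<bar>velocity z p\<bar> \<le> B p"
    by metis
  have speed: "\<bar>velocity (x t) p\<bar> \<le> (\<Sum>q\<in>I. \<bar>B q\<bar>)" if "p \<in> I" "0 \<le> t" for p t
  proof -
    have "\<bar>velocity (x t) p\<bar> \<le> \<bar>B p\<bar>"
      using B [OF that(1) x_feasible [OF that(2)]] by linarith
    also have "\<dots> \<le> (\<Sum>q\<in>I. \<bar>B q\<bar>)"
      by (rule member_le_sum) (use that finite_I in auto)
    finally show ?thesis .
  qed
  obtain b where b: "\<And>z. z \<in> feasible_flows D \<Longrightarrow> \<bar>potential z\<bar> \<le> b"
    using compact_imp_bounded [OF compact_continuous_image [OF continuous_on_potential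
      compact_feasible_flows]] by (force simp: bounded_iff)
  have Z: "Z = {z \<in> feasible_flows D. dissipation z = 0}"
    unfolding Z_def using dissipation_eq_0_iff by blast
  have decrease: "(\<Sum>p\<in>I. cost (x t) p * velocity (x t) p) \<le> - dissipation (x t)" if "0 \<le> t" for t
    using x_feasible [OF that] by (intro cost_velocity_le) (simp add: feasible_flows_def)
  have lower: "- b \<le> potential (x t)" if "0 \<le> t" for t
    using b [OF x_feasible [OF that]] by linarith
  note conv = bounded_speed_lyapunov_convergence [OF finite_I compact_feasible_flows x_feasible
    continuous_on_dissipation dissipation_nonneg DERIV_x speed DERIV_potential decrease lower Z]
  show "Z \<noteq> {}"
    by (rule conv(1)) assumption+
  show "((\<lambda>t. INF z\<in>Z. L2_set (\<lambda>p. x t p - z p) I) \<longlongrightarrow> 0) at_top"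
    by (rule conv(2)) assumption+
qed

end

section \<open>Local networks\<close>

text \<open>A simple path never returns to its start, so its first arc is the only one with tail
  \<open>u\<close>. The arc set thus determines the first arc, and removing it leaves equal arc sets
  for the induction.\<close>

lemma (in wf_digraph) apath_eq_of_set_eq:
  assumes "apath u p v" "apath u q w" "set p = set q"
  shows "p = q"
  using assms
proof (induction p arbitrary: u q)
  case Nil
  then show ?case
    by simp
next
  case (Cons e es)
  then obtain f fs where q: "q = f # fs"
    by (cases q) auto
  have notin: "g \<notin> set hs" if "apath u (h # hs) w" "tail G g = u" for g h hs w
  proof
    assume "g \<in> set hs"
    have "cas (head G h) hs w" "u \<notin> set (awalk_verts (head G h) hs)"
      using that(1) by (auto simp: apath_Cons_iff apath_def)
    then show False
      using \<open>g \<in> set hs\<close> that(2) by (auto simp: set_awalk_verts_cas)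
  qed
  have tails: "tail G e = u" "tail G f = u"
    using Cons.prems by (auto simp: q apath_Cons_iff)
  have notins: "e \<notin> set fs" "e \<notin> set es"
    using notin Cons.prems(1,2) tails unfolding q by blast+
  have "e = f"
    using Cons.prems(3) notins(1) by (auto simp: q)
  have "set es = set fs"
    using insert_ident [OF notins(2,1)] Cons.prems(3) \<open>e = f\<close> by (simp add: q)
  then have "es = fs"
    using Cons.prems \<open>e = f\<close> by (intro Cons.IH [of "head G e"]) (auto simp: q apath_Cons_iff)
  then show ?case
    using \<open>e = f\<close> by (simp add: q)
qed

lemma (in wf_digraph) apath_end_eq_of_set_eq:
  assumes "apath u p v" "apath u q w" "set p = set q"
  shows "v = w"
proof -
  have "cas u p v" "cas u q w" "p = q"
    using assms apath_eq_of_set_eq [OF assms] by (simp_all add: apath_def awalk_def)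
  then show ?thesis
    using awlast_if_cas by metis
qed

text \<open>
  At negative arguments the filter in \<open>marginal_time\<close> is trivial, so the value is an arbitrary
  number, but always the same one.
\<close>

lemma bounded_marginal_time:
  assumes cont: "continuous_on {0..} (marginal_time f)"
  shows "bounded (marginal_time f ` {u..v})"
proof -
  have "at w within {0..} = bot" if "w < 0" for w :: real
  proof -
    have "w \<notin> closure ({0..} - {w})"
      using that closure_mono [of "{0..} - {w}" "{0..}"] by auto
    then show ?thesis
      by (simp add: trivial_limit_within islimpt_in_closure)
  qed
  then have neg: "marginal_time f w = (SOME d. ((\<lambda>u. u * f u) has_vector_derivative d) bot)" if "w < 0" for w
    using that by (simp add: marginal_time_def vector_derivative_def)
  have "compact (marginal_time f ` {0..v})"
    by (intro compact_continuous_image continuous_on_subset [OF cont]) auto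
  \<comment> \<open>The argument \<open>-1\<close> represents all negative ones.\<close>
  then have "bounded (insert (marginal_time f (-1)) (marginal_time f ` {0..v}))"
    by (simp add: compact_imp_bounded)
  moreover have "marginal_time f ` {u..v} \<subseteq> insert (marginal_time f (-1)) (marginal_time f ` {0..v})"
  proof
    fix d assume "d \<in> marginal_time f ` {u..v}"
    then obtain w where w: "d = marginal_time f w" "w \<le> v"
      by auto
    show "d \<in> insert (marginal_time f (-1)) (marginal_time f ` {0..v})"
    proof (cases "w < 0")
      case True
      then show ?thesis
        using w neg [of w] neg [of "-1"] by simp
    qed (use w in auto)
  qed
  ultimately show ?thesis
    by (rule bounded_subset)
qed

text \<open>By the product rule the marginal time is \<open>f v + v * f' v\<close>, which involves
  no derivative beyond the continuous \<open>f'\<close>.\<close>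

lemma C1_on_nonneg_marginal_time:
  assumes "C1_on_nonneg f"
  shows "0 \<le> v \<Longrightarrow> ((\<lambda>u. u * f u) has_real_derivative marginal_time f v) (at v within {0..})"
    and "continuous_on {0..} (marginal_time f)"
proof -
  obtain f' where f': "\<And>v. 0 \<le> v \<Longrightarrow> (f has_real_derivative f' v) (at v within {0..})"
    and cont: "continuous_on {0..} f'"
    using assms unfolding C1_on_nonneg_def by blast
  have eq: "marginal_time f v = f v + v * f' v" if "0 \<le> v" for v
    using marginal_time_eq [OF that f' [OF that]] .
  show "((\<lambda>u. u * f u) has_real_derivative marginal_time f v) (at v within {0..})" if "0 \<le> v"
    unfolding eq [OF that] by (rule derivative_eq_intros f' that refl)+ simp
  have "continuous_on {0..} f"
    by (rule DERIV_continuous_on [where D = f']) (simp add: f')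
  then have "continuous_on {0..} (\<lambda>v. f v + v * f' v)"
    using cont by (intro continuous_intros)
  then show "continuous_on {0..} (marginal_time f)"
    by (rule continuous_on_eq) (simp add: eq)
qed

locale smooth_local_network =
  fixes N :: "('v, 'l, 's) local_network"
  assumes valid: "valid_network N"
    and C1: "\<And>a. a \<in> arcs (network N) \<Longrightarrow> C1_on_nonneg (ttime N a)"
begin

section \<open>The index set of the local flows\<close>

lemma finite_routes:
  assumes "(r, s) \<in> od_pairs N"
  shows "finite (local_dests N r s)" "\<omega> \<in> local_dests N r s \<Longrightarrow> finite (routes N r \<omega>)"
  using valid assms unfolding valid_network_def by fast+

lemma route_apath:
  assumes "(r, s, \<omega>, i) \<in> flow_indices N"
  obtains p where "pre_digraph.apath (network N) r p \<omega>" "i = set p"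
proof -
  have "(r, s) \<in> od_pairs N" "\<omega> \<in> local_dests N r s" "i \<in> routes N r \<omega>"
    using assms by (auto simp: flow_indices_def)
  then have "\<exists>p. pre_digraph.apath (network N) r p \<omega> \<and> i = set p"
    using valid unfolding valid_network_def by fast
  then show thesis
    using that by blast
qed

lemma route_arcs:
  assumes "(r, s, \<omega>, i) \<in> flow_indices N"
  shows "finite i" "i \<subseteq> arcs (network N)"
proof -
  obtain p where p: "pre_digraph.apath (network N) r p \<omega>" "i = set p"
    using route_apath [OF assms] .
  then show "finite i" "i \<subseteq> arcs (network N)"
    by (simp_all add: pre_digraph.apath_def pre_digraph.awalk_def)
qed

text \<open>
  In \<open>flow_rate\<close> the link set \<open>i\<close> is left out of \<open>routes N r \<kappa>\<close> for every \<open>\<kappa>\<close>; only \<open>\<kappa> = \<omega>\<close> is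
  affected.
\<close>

lemma route_end_unique:
  assumes "(r, s, \<omega>, i) \<in> flow_indices N" "(r, s, \<kappa>, i) \<in> flow_indices N"
  shows "\<omega> = \<kappa>"
proof -
  have wf: "wf_digraph (network N)"
    using valid by (simp add: valid_network_def)
  obtain p q where "pre_digraph.apath (network N) r p \<omega>" "i = set p"
      "pre_digraph.apath (network N) r q \<kappa>" "i = set q"
    using route_apath [OF assms(1)] route_apath [OF assms(2)] by metis
  then show ?thesis
    using wf_digraph.apath_end_eq_of_set_eq [OF wf] by blast
qed

lemma mem_flow_indices_iff:
  "(r, s, \<omega>, i) \<in> flow_indices N \<longleftrightarrow>
     (r, s) \<in> od_pairs N \<and> \<omega> \<in> local_dests N r s \<and> i \<in> routes N r \<omega>"
  by (simp add: flow_indices_def)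

text \<open>Regrouping the tuples presents the indices as nested dependent sums, from which
  finiteness and the iterated sums of the network definitions follow.\<close>

lemma flow_indices_eq:
  "flow_indices N = (\<lambda>((r, s), \<omega>, i). (r, s, \<omega>, i)) `
     (SIGMA (r, s) : od_pairs N. SIGMA \<omega> : local_dests N r s. routes N r \<omega>)"
  unfolding flow_indices_def by force

lemma finite_flow_indices: "finite (flow_indices N)"
proof -
  have "finite (od_pairs N)"
    using valid by (simp add: valid_network_def)
  then have "finite (SIGMA (r, s) : od_pairs N. SIGMA \<omega> : local_dests N r s. routes N r \<omega>)"
    by (rule finite_SigmaI) (auto intro!: finite_SigmaI finite_routes)
  then show ?thesis
    unfolding flow_indices_eq by (rule finite_imageI)
qed

lemma sum_flow_indices:
  "(\<Sum>p\<in>flow_indices N. f p) =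
     (\<Sum>(r, s)\<in>od_pairs N. \<Sum>\<omega>\<in>local_dests N r s. \<Sum>i\<in>routes N r \<omega>. f (r, s, \<omega>, i))"
proof -
  have fin: "finite (od_pairs N)"
    using valid by (simp add: valid_network_def)
  have "inj_on (\<lambda>((r, s), \<omega>, i). (r, s, \<omega>, i)) X" for X :: "(('v \<times> 's) \<times> 'v \<times> 'l set) set"
    by (auto simp: inj_on_def)
  then have "(\<Sum>p\<in>flow_indices N. f p) =
     (\<Sum>((r, s), \<omega>, i)\<in>(SIGMA (r, s) : od_pairs N. SIGMA \<omega> : local_dests N r s. routes N r \<omega>). f (r, s, \<omega>, i))"
    unfolding flow_indices_eq by (simp add: sum.reindex case_prod_unfold)
  also have "\<dots> = (\<Sum>(r, s)\<in>od_pairs N. \<Sum>(\<omega>, i)\<in>(SIGMA \<omega> : local_dests N r s. routes N r \<omega>). f (r, s, \<omega>, i))"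
    by (subst sum.Sigma [symmetric, OF fin])
      (auto intro!: finite_SigmaI finite_routes simp: case_prod_unfold)
  also have "\<dots> = (\<Sum>(r, s)\<in>od_pairs N. \<Sum>\<omega>\<in>local_dests N r s. \<Sum>i\<in>routes N r \<omega>. f (r, s, \<omega>, i))"
    by (rule sum.cong [OF refl]) (auto simp: sum.Sigma finite_routes)
  finally show ?thesis .
qed

text \<open>The extension by 0 is the normalization demanded by \<open>feasible_flows\<close>; it
  discards the meaningless values of a state.\<close>

definition flat :: "('v, 'l, 's) state \<Rightarrow> 'v \<times> 's \<times> 'v \<times> 'l set \<Rightarrow> real" where
  "flat y p = (if p \<in> flow_indices N then case p of (r, s, \<omega>, i) \<Rightarrow> y r s \<omega> i else 0)"

text \<open>The value 0 off \<open>od_pairs N\<close> matches the empty sums, since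
  \<open>feasible_flows\<close> constrains every group.\<close>

definition od_demand :: "'v \<times> 's \<Rightarrow> real" where
  "od_demand = (\<lambda>(r, s). if (r, s) \<in> od_pairs N then demand N r s else 0)"

sublocale flat: route_switching "flow_indices N" "\<lambda>(r, s, \<omega>, i). i" "\<lambda>(r, s, \<omega>, i). (r, s)"
  "\<lambda>(r, s, \<omega>, i). outer_mtime N s \<omega>" "\<lambda>(r, s). tolerance N r s"
  "\<lambda>a v. v * ttime N a v" "\<lambda>a. marginal_time (ttime N a)"
proof
  show "finite (flow_indices N)"
    by (rule finite_flow_indices)
next
  fix p assume p: "p \<in> flow_indices N"
  then obtain r s \<omega> i where [simp]: "p = (r, s, \<omega>, i)"
    by (metis prod_cases4)
  show "finite (case p of (r, s, \<omega>, i) \<Rightarrow> i)"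
    using route_arcs p by simp
  show "0 \<le> (case case p of (r, s, \<omega>, i) \<Rightarrow> (r, s) of (r, s) \<Rightarrow> tolerance N r s)"
    using valid p by (auto simp: valid_network_def flow_indices_def)
  fix a assume "a \<in> (case p of (r, s, \<omega>, i) \<Rightarrow> i)"
  then have a: "C1_on_nonneg (ttime N a)"
    using C1 route_arcs(2) [of r s \<omega> i] p by auto
  show "((\<lambda>v. v * ttime N a v) has_real_derivative marginal_time (ttime N a) v) (at v within {0..})"
    if "0 \<le> v" for v
    using C1_on_nonneg_marginal_time(1) [OF a that] .
  show "continuous_on {0..} (marginal_time (ttime N a))"
    using C1_on_nonneg_marginal_time(2) [OF a] .
  then show "bounded (marginal_time (ttime N a) ` {u..v})" for u v
    by (rule bounded_marginal_time)
qed

section \<open>Correspondence between flat flows and network states\<close>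

lemma flat_load: "flat.load (flat y) a = link_flow N y a"
proof -
  have "flat.load (flat y) a =
      (\<Sum>p\<in>flow_indices N. case p of (r, s, \<omega>, i) \<Rightarrow> if a \<in> i then y r s \<omega> i else 0)"
    unfolding flat.load_def sum.inter_filter [OF finite_flow_indices]
    by (intro sum.cong) (auto simp: flat_def)
  also have "\<dots> = link_flow N y a"
    unfolding sum_flow_indices link_flow_def
    by (rule sum.cong [OF refl], clarify, rule sum.cong [OF refl])
      (simp add: sum.inter_filter finite_routes)
  finally show ?thesis .
qed

text \<open>Subtracting \<open>outer_diff N s \<omega> \<kappa>\<close> adds the outer time at
  \<open>\<omega>\<close> and removes the one at \<open>\<kappa>\<close>, which turns a difference
  of route times into a difference of costs.\<close>

lemma flat_rate: "flat.rate (flat y) (r, s, \<omega>, i) (r, s, \<kappa>, j) = switch_rate N y r s \<omega> i \<kappa> j"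
  by (simp add: flat.rate_def flat.cost_def flat_load switch_rate_def pos_part_def route_mtime_def
    outer_diff_def algebra_simps)

lemma sum_flow_indices_group:
  assumes "(r, s) \<in> od_pairs N"
  shows "(\<Sum>p | p \<in> flow_indices N \<and> (case p of (r, s, \<omega>, i) \<Rightarrow> (r, s)) = (r, s). f p) =
    (\<Sum>\<omega>\<in>local_dests N r s. \<Sum>i\<in>routes N r \<omega>. f (r, s, \<omega>, i))"
proof -
  have "{p. p \<in> flow_indices N \<and> (case p of (r, s, \<omega>, i) \<Rightarrow> (r, s)) = (r, s)} =
      (\<lambda>(\<omega>, i). (r, s, \<omega>, i)) ` (SIGMA \<omega> : local_dests N r s. routes N r \<omega>)"
    using assms by (auto simp: flow_indices_def)
  moreover have "inj_on (\<lambda>(\<omega>, i). (r, s, \<omega>, i)) (SIGMA \<omega> : local_dests N r s. routes N r \<omega>)"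
    by (auto simp: inj_on_def)
  ultimately have "(\<Sum>p | p \<in> flow_indices N \<and> (case p of (r, s, \<omega>, i) \<Rightarrow> (r, s)) = (r, s). f p) =
      (\<Sum>(\<omega>, i)\<in>(SIGMA \<omega> : local_dests N r s. routes N r \<omega>). f (r, s, \<omega>, i))"
    by (simp add: sum.reindex case_prod_unfold)
  also have "\<dots> = (\<Sum>\<omega>\<in>local_dests N r s. \<Sum>i\<in>routes N r \<omega>. f (r, s, \<omega>, i))"
    by (rule sum.Sigma [symmetric]) (use finite_routes [OF assms] in auto)
  finally show ?thesis .
qed

lemma flat_velocity:
  assumes p: "(r, s, \<omega>, i) \<in> flow_indices N"
  shows "flat.velocity (flat y) (r, s, \<omega>, i) = flow_rate N y r s \<omega> i"
proof -
  let ?t = "\<lambda>q. flat.rate (flat y) q (r, s, \<omega>, i) * flat y q -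
    flat.rate (flat y) (r, s, \<omega>, i) q * flat y (r, s, \<omega>, i)"
  have rs: "(r, s) \<in> od_pairs N" and idx: "\<omega> \<in> local_dests N r s" "i \<in> routes N r \<omega>"
    using p by (auto simp: flow_indices_def)
  have "flat.velocity (flat y) (r, s, \<omega>, i) = (\<Sum>q\<in>flow_indices N. ?t q)"
    by (simp add: flat.velocity_def)
  also have "\<dots> = (\<Sum>q | q \<in> flow_indices N \<and> (case q of (r, s, \<omega>, i) \<Rightarrow> (r, s)) = (r, s). ?t q)"
    by (rule sum.mono_neutral_right) (auto simp: finite_flow_indices flat.rate_def)
  also have "\<dots> = (\<Sum>\<kappa>\<in>local_dests N r s. \<Sum>j\<in>routes N r \<kappa>. ?t (r, s, \<kappa>, j))"
    by (rule sum_flow_indices_group [OF rs])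
  \<comment> \<open>By uniqueness of end nodes, the only term removed is the diagonal one, in which
    gain and loss cancel.\<close>
  also have "\<dots> = (\<Sum>\<kappa>\<in>local_dests N r s. \<Sum>j\<in>routes N r \<kappa> - {i}. ?t (r, s, \<kappa>, j))"
  proof (rule sum.cong [OF refl])
    fix \<kappa> assume \<kappa>: "\<kappa> \<in> local_dests N r s"
    have "?t (r, s, \<kappa>, i) = 0" if "i \<in> routes N r \<kappa>"
    proof -
      have "(r, s, \<kappa>, i) \<in> flow_indices N"
        using rs \<kappa> that by (simp add: flow_indices_def)
      then show ?thesis
        using route_end_unique [OF p] by simp
    qed
    then show "(\<Sum>j\<in>routes N r \<kappa>. ?t (r, s, \<kappa>, j)) = (\<Sum>j\<in>routes N r \<kappa> - {i}. ?t (r, s, \<kappa>, j))"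
      by (intro sum.mono_neutral_right) (use finite_routes rs \<kappa> in auto)
  qed
  also have "\<dots> = flow_rate N y r s \<omega> i"
    unfolding flow_rate_def
    by (intro sum.cong refl) (use rs idx in \<open>simp add: flat_rate flat_def mem_flow_indices_iff\<close>)
  finally show ?thesis .
qed

lemma flat_feasible: "flat y \<in> flat.feasible_flows od_demand \<longleftrightarrow> feasible N y"
proof -
  have sums: "(\<Sum>p | p \<in> flow_indices N \<and> (case p of (r, s, \<omega>, i) \<Rightarrow> (r, s)) = (r, s). flat y p) =
      (if (r, s) \<in> od_pairs N then \<Sum>\<omega>\<in>local_dests N r s. \<Sum>i\<in>routes N r \<omega>. y r s \<omega> i else 0)" for r s
  proof (cases "(r, s) \<in> od_pairs N")
    case True
    then show ?thesis
      unfolding sum_flow_indices_group [OF True]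
      by (auto intro!: sum.cong simp: flat_def mem_flow_indices_iff)
  next
    case False
    then have "{p. p \<in> flow_indices N \<and> (case p of (r, s, \<omega>, i) \<Rightarrow> (r, s)) = (r, s)} = {}"
      by (auto simp: flow_indices_def)
    then show ?thesis
      unfolding if_not_P [OF False] by (simp only: sum.empty)
  qed
  have nonneg: "(\<forall>p\<in>flow_indices N. 0 \<le> flat y p) \<longleftrightarrow> (\<forall>(r, s, \<omega>, i)\<in>flow_indices N. 0 \<le> y r s \<omega> i)"
    by (auto simp: flat_def)
  have "(\<forall>j. (\<Sum>p | p \<in> flow_indices N \<and> (case p of (r, s, \<omega>, i) \<Rightarrow> (r, s)) = j. flat y p) = od_demand j) \<longleftrightarrow>
      (\<forall>(r, s)\<in>od_pairs N. (\<Sum>\<omega>\<in>local_dests N r s. \<Sum>i\<in>routes N r \<omega>. y r s \<omega> i) = demand N r s)"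
    unfolding split_paired_All sums od_demand_def by auto
  moreover have "\<forall>p. p \<notin> flow_indices N \<longrightarrow> flat y p = 0"
    by (simp add: flat_def)
  ultimately show ?thesis
    unfolding flat.feasible_flows_def feasible_def mem_Collect_eq nonneg by argo
qed

lemma flat_equilibrium:
  "(\<forall>p\<in>flow_indices N. \<forall>q\<in>flow_indices N. flat.rate (flat y) p q * flat y p = 0) \<longleftrightarrow> y \<in> ALSO_set N"
proof
  assume eq: "\<forall>p\<in>flow_indices N. \<forall>q\<in>flow_indices N. flat.rate (flat y) p q * flat y p = 0"
  have "switch_rate N y r s \<omega> i \<kappa> j * y r s \<omega> i = 0"
    if "(r, s, \<omega>, i) \<in> flow_indices N" "(r, s, \<kappa>, j) \<in> flow_indices N" for r s \<omega> i \<kappa> j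
    using bspec [OF bspec [OF eq that(1)] that(2)] that by (simp only: flat_rate) (simp add: flat_def)
  then show "y \<in> ALSO_set N"
    by (simp add: ALSO_set_def mem_flow_indices_iff) metis
next
  assume y: "y \<in> ALSO_set N"
  show "\<forall>p\<in>flow_indices N. \<forall>q\<in>flow_indices N. flat.rate (flat y) p q * flat y p = 0"
  proof (intro ballI)
    fix p q assume pq: "p \<in> flow_indices N" "q \<in> flow_indices N"
    obtain r s \<omega> i r' s' \<kappa> j where [simp]: "p = (r, s, \<omega>, i)" "q = (r', s', \<kappa>, j)"
      by (metis prod_cases4)
    show "flat.rate (flat y) p q * flat y p = 0"
    proof (cases "(r, s) = (r', s')")
      case True
      then have "switch_rate N y r s \<omega> i \<kappa> j * y r s \<omega> i = 0"
        using y pq by (simp add: ALSO_set_def mem_flow_indices_iff) metis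
      then show ?thesis
        using True pq by (auto simp: flat_rate flat_def)
    next
      case False
      then show ?thesis
        by (auto simp: flat.rate_def)
    qed
  qed
qed

lemma state_dist_flat: "state_dist N x y = L2_set (\<lambda>p. flat x p - flat y p) (flow_indices N)"
  unfolding state_dist_def by (intro L2_set_cong) (auto simp: flat_def)

text \<open>Distances between states depend only on their flat versions, so this equality of sets
  carries both non-emptiness and the infimum over to states.\<close>

lemma flat_image_ALSO:
  "flat ` {y \<in> ALSO_set N. feasible N y} = {z \<in> flat.feasible_flows od_demand.
     \<forall>p\<in>flow_indices N. \<forall>q\<in>flow_indices N. flat.rate z p q * z p = 0}" (is "_ = ?Z")
proof
  show "flat ` {y \<in> ALSO_set N. feasible N y} \<subseteq> ?Z"
    using flat_equilibrium flat_feasible by blast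
  show "?Z \<subseteq> flat ` {y \<in> ALSO_set N. feasible N y}"
  proof
    fix z assume z: "z \<in> ?Z"
    \<comment> \<open>Currying \<open>z\<close> gives a preimage because \<open>z\<close> already
      vanishes off the flow indices.\<close>
    define y where "y r s \<omega> i = z (r, s, \<omega>, i)" for r s \<omega> i
    have "flat y = z"
      using z by (auto simp: flat_def y_def flat.feasible_flows_def fun_eq_iff)
    then show "z \<in> flat ` {y \<in> ALSO_set N. feasible N y}"
      using z flat_equilibrium [of y] flat_feasible [of y] by blast
  qed
qed

lemma solution_converges:
  assumes sol: "is_solution N x" and init: "feasible N (x 0)"
  defines "S \<equiv> {y \<in> ALSO_set N. feasible N y}"
  shows "S \<noteq> {}" "((\<lambda>t. state_setdist N (x t) S) \<longlongrightarrow> 0) at_top"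
proof -
  interpret route_switching_solution "flow_indices N" "\<lambda>(r, s, \<omega>, i). i" "\<lambda>(r, s, \<omega>, i). (r, s)"
    "\<lambda>(r, s, \<omega>, i). outer_mtime N s \<omega>" "\<lambda>(r, s). tolerance N r s"
    "\<lambda>a v. v * ttime N a v" "\<lambda>a. marginal_time (ttime N a)" "\<lambda>t. flat (x t)" od_demand
  proof
    fix p and t :: real assume p: "p \<in> flow_indices N" and t: "0 \<le> t"
    obtain r s \<omega> i where [simp]: "p = (r, s, \<omega>, i)"
      by (metis prod_cases4)
    have "((\<lambda>\<tau>. x \<tau> r s \<omega> i) has_real_derivative flow_rate N (x t) r s \<omega> i) (at t within {0..})"
      using sol p t by (auto simp: is_solution_def)
    moreover have "(\<lambda>\<tau>. flat (x \<tau>) p) = (\<lambda>\<tau>. x \<tau> r s \<omega> i)"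
      using p by (simp add: flat_def)
    ultimately show "((\<lambda>\<tau>. flat (x \<tau>) p) has_real_derivative flat.velocity (flat (x t)) p)
        (at t within {0..})"
      using flat_velocity p by simp
  next
    show "flat (x 0) \<in> flat.feasible_flows od_demand"
      using init by (simp add: flat_feasible)
    show "flat (x t) p = 0" if "p \<notin> flow_indices N" for p t
      using that by (simp add: flat_def)
  qed
  show "S \<noteq> {}"
    using converges_to_equilibria(1) flat_image_ALSO unfolding S_def by force
  show "((\<lambda>t. state_setdist N (x t) S) \<longlongrightarrow> 0) at_top"
    using converges_to_equilibria(2) unfolding flat_image_ALSO [symmetric] S_def [symmetric]
    by (simp add: state_setdist_def state_dist_flat image_image)
qed

end

theorem theorem4:
  fixes N :: "('v, 'l, 's) local_network"
    and x :: "real \<Rightarrow> ('v, 'l, 's) state"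
  assumes "valid_network N"
    and "\<And>a. a \<in> arcs (network N) \<Longrightarrow> C1_on_nonneg (ttime N a)"
    and "\<And>a. a \<in> arcs (network N) \<Longrightarrow> mono_on {0..} (ttime N a)"
    and "is_solution N x"
    and "feasible N (x 0)"
  shows "{y \<in> ALSO_set N. feasible N y} \<noteq> {} \<and>
    ((\<lambda>t. state_setdist N (x t) {y \<in> ALSO_set N. feasible N y}) \<longlongrightarrow> 0) at_top"
proof -
  interpret smooth_local_network N
    using assms by unfold_locales
  show ?thesis
    using solution_converges [OF assms(4,5)] by blast
qed

end
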